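(* Let $n\ge 1$ be an integer, $\kappa>0$, let $C\subset\mathbb{H}^n_\kappa$ be a closed $\kappa$-hyperbolically convex set and $f:\mathbb{H}^n_\kappa\to\mathbb{R}$ a differentiable function such that the problem of minimizing $f$ over $C$ has a nonempty solution set, with optimum value $f^*:=\inf_{p\in C}f(p)>-\infty$. Assume that $\operatorname{grad} f$ is Lipschitz continuous on $C$ with constant $L\ge 0$, and let $0<\alpha<1/L$ (with $1/L:=+\infty$ if $L=0$). Let $p_0\in C$ and let $(p_k)_{k\in\mathbb{N}}$ be defined by $$p_{k+1}:=P^\kappa_C\big(\exp^\kappa_{p_k}(-\alpha\operatorname{grad} f(p_k))\big),\qquad k=0,1,\dots,$$ and assume $\operatorname{grad} f(p_k)\ne 0$ for all $k$. If $\bar p\in C$ is a cluster point of $(p_k)_{k\in\mathbb{N}}$, then $\bar p$ is a stationary point of the problem of minimizing $f$ over $C$.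
   Context: For $x,y\in\mathbb{R}^{n+1}$ the Lorentzian inner product is $\langle x,y\rangle:=x_1y_1+\dots+x_ny_n-x_{n+1}y_{n+1}$. The $\kappa$-hyperbolic space form is $\mathbb{H}^n_\kappa:=\{p\in\mathbb{R}^{n+1}:\langle p,p\rangle=-1/\kappa,\ p_{n+1}>0\}$, with tangent space $T_p\mathbb{H}^n_\kappa:=\{v\in\mathbb{R}^{n+1}:\langle p,v\rangle=0\}$, on which $\langle\cdot,\cdot\rangle$ is positive definite (a Riemannian metric), with norm $\|v\|=\sqrt{\langle v,v\rangle}$. The intrinsic distance is $d_\kappa(p,q):=\frac{1}{\sqrt\kappa}\operatorname{arcosh}(-\kappa\langle p,q\rangle)$. Exponential map: $\exp^\kappa_p(0)=p$ and $\exp^\kappa_p(v)=\cosh(\sqrt\kappa\|v\|)\,p+\sinh(\sqrt\kappa\|v\|)\frac{v}{\sqrt\kappa\|v\|}$ for $0\ne v\in T_p\mathbb{H}^n_\kappa$. Its inverse is $\log^\kappa_p p=0$ and $\log^\kappa_p q=d_\kappa(p,q)\frac{q+\kappa\langle p,q\rangle p}{\|q+\kappa\langle p,q\rangle p\|}$ for $q\ne p$. The geodesic segment joining $p$ to $q$ is $\{\exp^\kappa_p(t\log^\kappa_p q):t\in[0,1]\}$. A set $C\subseteq\mathbb{H}^n_\kappa$ is $\kappa$-hyperbolically convex if for all $p,q\in C$ the geodesic segment joining $p$ to $q$ is contained in $C$. For a nonempty closed $\kappa$-hyperbolically convex set $C$, the intrinsic $\kappa$-projection $P^\kappa_C(p)$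 of $p\in\mathbb{H}^n_\kappa$ is the unique minimizer of $q\mapsto d_\kappa(p,q)$ over $q\in C$. $\operatorname{grad} f(p)\in T_p\mathbb{H}^n_\kappa$ is the Riemannian gradient: $df(p)v=\langle\operatorname{grad} f(p),v\rangle$ for all $v\in T_p\mathbb{H}^n_\kappa$. Parallel transport $P_{pq}:T_p\mathbb{H}^n_\kappa\to T_q\mathbb{H}^n_\kappa$ is $P_{pq}(v)=v-\frac{\kappa\langle q,v\rangle}{\kappa\langle p,q\rangle-1}(p+q)$. $\operatorname{grad} f$ is Lipschitz continuous on $C$ with constant $L$ if $\|P_{pq}\operatorname{grad} f(p)-\operatorname{grad} f(q)\|\le L\,d_\kappa(p,q)$ for all $p,q\in C$. A point $\bar p\in C$ is stationary for minimizing $f$ over $C$ if $\langle\operatorname{grad} f(\bar p),p\rangle\ge 0$ for all $p\in C$. A cluster point of a sequence is a limit of some subsequence. *)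

theory Defs
  imports "HOL-Analysis.Analysis"
begin

text \<open>
  The ambient space of dimension \<open>n + 1\<close> is \<open>(real ^ 'n) \<times> real\<close> with \<open>n = CARD('n) \<ge> 1\<close>: the first
  component holds the coordinates \<open>x\<^sub>1, \<dots>, x\<^sub>n\<close>, the second one the coordinate \<open>x\<^sub>n\<^sub>+\<^sub>1\<close>.
  Its topology is the Euclidean one; the metric topology of \<open>hdist\<close> on the hyperboloid is the
  subspace topology.
\<close>

type_synonym 'n lorentz = "(real ^ 'n) \<times> real"

definition lorentz_inner :: "'n::finite lorentz \<Rightarrow> 'n lorentz \<Rightarrow> real" where
  "lorentz_inner x y = (\<Sum>i\<in>UNIV. fst x $ i * fst y $ i) - snd x * snd y"

definition lorentz_norm :: "'n::finite lorentz \<Rightarrow> real" where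
  "lorentz_norm v = sqrt (lorentz_inner v v)"

definition hyp_space :: "real \<Rightarrow> 'n::finite lorentz set" where
  "hyp_space \<kappa> = {p. lorentz_inner p p = - 1 / \<kappa> \<and> snd p > 0}"

definition tangent_space :: "'n::finite lorentz \<Rightarrow> 'n lorentz set" where
  "tangent_space p = {v. lorentz_inner p v = 0}"

definition hdist :: "real \<Rightarrow> 'n::finite lorentz \<Rightarrow> 'n lorentz \<Rightarrow> real" where
  "hdist \<kappa> p q = 1 / sqrt \<kappa> * arcosh (- \<kappa> * lorentz_inner p q)"

definition hexp :: "real \<Rightarrow> 'n::finite lorentz \<Rightarrow> 'n lorentz \<Rightarrow> 'n lorentz" where
  "hexp \<kappa> p v =
     (if v = 0 then p
      else cosh (sqrt \<kappa> * lorentz_norm v) *\<^sub>R p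
         + (sinh (sqrt \<kappa> * lorentz_norm v) / (sqrt \<kappa> * lorentz_norm v)) *\<^sub>R v)"

definition hlog :: "real \<Rightarrow> 'n::finite lorentz \<Rightarrow> 'n lorentz \<Rightarrow> 'n lorentz" where
  "hlog \<kappa> p q =
     (if q = p then 0
      else (let u = q + (\<kappa> * lorentz_inner p q) *\<^sub>R p
            in (hdist \<kappa> p q / lorentz_norm u) *\<^sub>R u))"

definition geodesic_segment :: "real \<Rightarrow> 'n::finite lorentz \<Rightarrow> 'n lorentz \<Rightarrow> 'n lorentz set" where
  "geodesic_segment \<kappa> p q = (\<lambda>t. hexp \<kappa> p (t *\<^sub>R hlog \<kappa> p q)) ` {0..1}"

definition hyp_convex :: "real \<Rightarrow> 'n::finite lorentz set \<Rightarrow> bool" where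
  "hyp_convex \<kappa> C \<longleftrightarrow>
     C \<subseteq> hyp_space \<kappa> \<and> (\<forall>p\<in>C. \<forall>q\<in>C. geodesic_segment \<kappa> p q \<subseteq> C)"

definition hproj :: "real \<Rightarrow> 'n::finite lorentz set \<Rightarrow> 'n lorentz \<Rightarrow> 'n lorentz" where
  "hproj \<kappa> C p = (THE q. is_arg_min (hdist \<kappa> p) (\<lambda>q. q \<in> C) q)"

text \<open>
  A function on the hyperboloid is represented by a function on the ambient space of which only the
  values on \<open>hyp_space \<kappa>\<close> matter, and differentiability is taken within \<open>hyp_space \<kappa>\<close>; for an
  embedded submanifold this is differentiability on the manifold. A derivative \<open>D\<close> within
  \<open>hyp_space \<kappa>\<close> is determined on the tangent space only, where it is the differential \<open>df(p)\<close>.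
\<close>

definition hgrad :: "real \<Rightarrow> ('n::finite lorentz \<Rightarrow> real) \<Rightarrow> 'n lorentz \<Rightarrow> 'n lorentz" where
  "hgrad \<kappa> f p =
     (THE g. g \<in> tangent_space p \<and>
        (\<exists>D. (f has_derivative D) (at p within hyp_space \<kappa>) \<and>
             (\<forall>v\<in>tangent_space p. D v = lorentz_inner g v)))"

definition parallel_transport ::
  "real \<Rightarrow> 'n::finite lorentz \<Rightarrow> 'n lorentz \<Rightarrow> 'n lorentz \<Rightarrow> 'n lorentz" where
  "parallel_transport \<kappa> p q v =
     v - (\<kappa> * lorentz_inner q v / (\<kappa> * lorentz_inner p q - 1)) *\<^sub>R (p + q)"

definition grad_lipschitz_on ::
  "real \<Rightarrow> ('n::finite lorentz \<Rightarrow> real) \<Rightarrow> 'n lorentz set \<Rightarrow> real \<Rightarrow> bool" where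
  "grad_lipschitz_on \<kappa> f C L \<longleftrightarrow>
     (\<forall>p\<in>C. \<forall>q\<in>C.
        lorentz_norm (parallel_transport \<kappa> p q (hgrad \<kappa> f p) - hgrad \<kappa> f q) \<le> L * hdist \<kappa> p q)"

definition stationary_point ::
  "real \<Rightarrow> ('n::finite lorentz \<Rightarrow> real) \<Rightarrow> 'n lorentz set \<Rightarrow> 'n lorentz \<Rightarrow> bool" where
  "stationary_point \<kappa> f C pbar \<longleftrightarrow>
     pbar \<in> C \<and> (\<forall>p\<in>C. lorentz_inner (hgrad \<kappa> f pbar) p \<ge> 0)"

definition cluster_point :: "(nat \<Rightarrow> 'a::topological_space) \<Rightarrow> 'a \<Rightarrow> bool" where
  "cluster_point X l \<longleftrightarrow> (\<exists>r. strict_mono r \<and> (X \<circ> r) \<longlonglongrightarrow> l)"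

end

theory Submission
  imports Defs
begin

text \<open>
  By the mean value theorem along the geodesic from \<open>p\<^sub>k\<close> to \<open>p\<^sub>k\<^sub>+\<^sub>1\<close>, whose velocity is parallel, the
  Lipschitz condition bounds \<open>f(p\<^sub>k\<^sub>+\<^sub>1)\<close> by \<open>f(p\<^sub>k) + \<langle>grad f(p\<^sub>k), log p\<^sub>k\<^sub>+\<^sub>1\<rangle> + L d\<^sup>2\<close> with
  \<open>d = d(p\<^sub>k, p\<^sub>k\<^sub>+\<^sub>1)\<close>. The variational inequality of the projection makes the angle at \<open>p\<^sub>k\<^sub>+\<^sub>1\<close> in the
  triangle of \<open>p\<^sub>k\<close>, \<open>p\<^sub>k\<^sub>+\<^sub>1\<close> and the unprojected point at least \<open>\<pi> / 2\<close>, and hyperbolic trigonometry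
  bounds the scalar product by \<open>- d\<^sup>2 / \<alpha>\<close>. So \<open>f(p\<^sub>k)\<close> decreases by at least \<open>(1 / \<alpha> - L) d\<^sup>2\<close>,
  whence \<open>d\<close> tends to \<open>0\<close>. Along a subsequence converging to a cluster point the gradients converge,
  and the variational inequality, which is linear in the test point, passes to the limit.
\<close>

section \<open>The Lorentzian form as a bounded bilinear map\<close>

lemma lorentz_inner_eq: "lorentz_inner x y = fst x \<bullet> fst y - snd x * snd y"
  by (simp add: lorentz_inner_def inner_vec_def)

lemma lorentz_inner_commute: "lorentz_inner x y = lorentz_inner y x"
  by (simp add: lorentz_inner_eq inner_commute mult.commute)

text \<open>The form is indefinite, but its spatial and its last part are each bounded by the
  product of the Euclidean norms. The interpretation below then supplies the algebraic, continuity
  and limit rules.\<close>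

lemma bounded_bilinear_lorentz_inner:
  "bounded_bilinear (lorentz_inner :: 'n::finite lorentz \<Rightarrow> _)"
proof
  show "\<exists>K. \<forall>a b :: 'n lorentz. norm (lorentz_inner a b) \<le> norm a * norm b * K"
  proof (intro exI[of _ 2] allI)
    fix a b :: "'n lorentz"
    have "\<bar>fst a \<bullet> fst b\<bar> \<le> norm a * norm b"
      by (rule order_trans[OF Cauchy_Schwarz_ineq2 mult_mono]) (metis norm_fst_le prod.collapse, metis norm_fst_le prod.collapse, simp_all)
    moreover have "\<bar>snd a * snd b\<bar> \<le> norm a * norm b"
      unfolding real_norm_def[symmetric] norm_mult
      by (intro mult_mono) (metis norm_snd_le prod.collapse, metis norm_snd_le prod.collapse, simp_all)
    ultimately show "norm (lorentz_inner a b) \<le> norm a * norm b * 2"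
      by (simp add: lorentz_inner_eq)
  qed
qed (simp_all add: lorentz_inner_eq algebra_simps)

interpretation lorentz: bounded_bilinear "lorentz_inner :: 'n::finite lorentz \<Rightarrow> _"
  by (rule bounded_bilinear_lorentz_inner)

lemmas lorentz_simps =
  lorentz.add_left lorentz.add_right lorentz.diff_left lorentz.diff_right
  lorentz.scaleR_left lorentz.scaleR_right lorentz.minus_left lorentz.minus_right

section \<open>Hyperbolic functions of a real variable and obtuse triangles\<close>

lemma self_le_sinh:
  assumes "x \<ge> 0" shows "x \<le> sinh (x::real)"
proof -
  have "(\<lambda>x. sinh x - x) 0 \<le> (\<lambda>x. sinh x - x) (x::real)"
    by (rule DERIV_nonneg_imp_nondecreasing[OF assms])
      (auto intro!: derivative_eq_intros exI simp: cosh_real_ge_1)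
  then show ?thesis by simp
qed

text \<open>The derivative of \<open>tanh x / x\<close> has the sign of
  \<open>x - sinh x * cosh x\<close>, which is nonpositive because \<open>x \<le> sinh x\<close> and
  \<open>cosh x \<ge> 1\<close>.\<close>

lemma tanh_div_antimono:
  assumes "0 < a" "a \<le> (c::real)" shows "tanh c / c \<le> tanh a / a"
proof (rule DERIV_nonpos_imp_nonincreasing[of a c "\<lambda>x. tanh x / x"])
  fix x :: real assume "a \<le> x" "x \<le> c"
  with assms have x: "x > 0" by simp
  have "x \<le> sinh x * cosh x"
    using order_trans[OF self_le_sinh[of x], of "sinh x * cosh x"] x
    by (simp add: mult_le_cancel_left1 cosh_real_ge_1)
  moreover have "1 - tanh x ^ 2 = 1 / cosh x ^ 2"
    by (simp add: tanh_def field_simps sinh_square_eq)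
  ultimately have "((1 - tanh x ^ 2) * x - tanh x * 1) / (x * x) \<le> 0"
    using x by (simp add: tanh_def divide_simps power2_eq_square mult.commute not_less)
  moreover have "((\<lambda>x. tanh x / x) has_real_derivative ((1 - tanh x ^ 2) * x - tanh x * 1) / (x * x)) (at x)"
    using x by (auto intro!: derivative_eq_intros)
  ultimately show "\<exists>y. ((\<lambda>x. tanh x / x) has_real_derivative y) (at x) \<and> y \<le> 0" by blast
qed fact

text \<open>In a triangle with sides \<open>a\<close>, \<open>c\<close> enclosing an angle of cosine \<open>b\<close>, the hypothesis says
  that the angle opposite to \<open>c\<close> is at least \<open>\<pi> / 2\<close>.\<close>

lemma obtuse_triangle:
  fixes a b c :: real
  assumes "0 < a" "0 < c" "b \<le> 1" "cosh c * sinh a \<le> cosh a * sinh c * b"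
  shows "a \<le> c * b"
proof -
  \<comment> \<open>Division of the hypothesis by \<open>cosh a * cosh c\<close>. Since
    \<open>b \<le> 1\<close>, this also gives \<open>a \<le> c\<close>, and the monotonicity of
    \<open>tanh x / x\<close> turns the bound on \<open>tanh a\<close> into one on
    \<open>a\<close>.\<close>
  have le: "tanh a \<le> tanh c * b"
    using assms(4) by (simp add: tanh_def divide_simps mult_ac)
  also have "\<dots> \<le> tanh c" using assms by (simp add: mult_left_le)
  finally have "a \<le> c" by simp
  then have "tanh c * a \<le> tanh a * c"
    using tanh_div_antimono[of a c] assms by (simp add: field_simps)
  also have "\<dots> \<le> tanh c * (c * b)"
    using le assms(2) by (simp add: mult.assoc mult_right_mono mult.left_commute mult.commute)
  finally show ?thesis using assms(2) by simp
qed

section \<open>The hyperboloid and its tangent spaces\<close>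

locale hyperbolic_space_form =
  fixes \<kappa> :: real
  assumes kappa_pos: "\<kappa> > 0"
begin

lemma hyp_spaceD:
  assumes "p \<in> hyp_space \<kappa>"
  shows "lorentz_inner p p = - 1 / \<kappa>" "snd p > 0"
  using assms by (auto simp: hyp_space_def)

text \<open>On the quadric the last coordinate cannot vanish, since the form would be nonnegative
  there; so the strict condition \<open>snd p > 0\<close> may be weakened to a closed one.
  Relatively closed sets thus become closed in the ambient space, where compactness is
  available.\<close>

lemma closed_hyp_space: "closed (hyp_space \<kappa> :: 'n::finite lorentz set)"
proof -
  have "snd p \<noteq> 0" if "lorentz_inner p p = - 1 / \<kappa>" for p :: "'n lorentz"
  proof
    assume "snd p = 0"
    then have "lorentz_inner p p \<ge> 0" by (simp add: lorentz_inner_eq)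
    moreover have "- 1 / \<kappa> < 0" using kappa_pos by simp
    ultimately show False using that by simp
  qed
  then have "hyp_space \<kappa> = {p :: 'n lorentz. lorentz_inner p p = - 1 / \<kappa>} \<inter> {p. 0 \<le> snd p}"
    by (auto simp: hyp_space_def less_le)
  then show ?thesis
    by (simp add: closed_Int closed_Collect_eq closed_Collect_le lorentz.continuous_on
        continuous_intros)
qed

text \<open>Cauchy-Schwarz for the spatial parts, with the tangency relation substituted, bounds the
  Euclidean norm by the Lorentz length. The factor involves the height \<open>snd p\<close>, as the
  two norms are not uniformly comparable over the hyperboloid. Definiteness on tangent spaces and
  the passage from Lorentz lengths to Euclidean limits rest on this.\<close>

lemma norm_tangent_le:
  assumes p: "p \<in> hyp_space \<kappa>" and v: "lorentz_inner p v = 0"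
  shows "(norm v)\<^sup>2 \<le> 2 * \<kappa> * (snd p)\<^sup>2 * lorentz_inner v v"
proof -
  define s t where "s = snd p" and "t = snd v"
  have s: "s > 0" using hyp_spaceD[OF p] by (simp add: s_def)
  have pp: "fst p \<bullet> fst p = s\<^sup>2 - 1 / \<kappa>"
    using hyp_spaceD[OF p] by (simp add: lorentz_inner_eq s_def power2_eq_square)
  have pv: "fst p \<bullet> fst v = s * t" using v by (simp add: lorentz_inner_eq s_def t_def)
  have "(s * t)\<^sup>2 \<le> (s\<^sup>2 - 1 / \<kappa>) * (fst v \<bullet> fst v)"
    using Cauchy_Schwarz_ineq[of "fst p" "fst v"] by (simp add: pp pv)
  \<comment> \<open>The factor \<open>fst v \<bullet> fst v - t\<^sup>2\<close> is
    \<open>lorentz_inner v v\<close>.\<close>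
  then have *: "(fst v \<bullet> fst v) / \<kappa> \<le> s\<^sup>2 * (fst v \<bullet> fst v - t\<^sup>2)"
    by (simp add: algebra_simps power_mult_distrib)
  moreover have "0 \<le> (fst v \<bullet> fst v) / \<kappa>" using kappa_pos by simp
  ultimately have "0 \<le> s\<^sup>2 * (fst v \<bullet> fst v - t\<^sup>2)" by linarith
  then have t: "t\<^sup>2 \<le> fst v \<bullet> fst v" using s by (simp add: zero_le_mult_iff)
  have "(norm v)\<^sup>2 = fst v \<bullet> fst v + t\<^sup>2"
    unfolding power2_norm_eq_inner by (simp add: inner_prod_def t_def power2_eq_square)
  also have "\<dots> \<le> 2 * (fst v \<bullet> fst v)" using t by simp
  also have "\<dots> \<le> 2 * (\<kappa> * (s\<^sup>2 * (fst v \<bullet> fst v - t\<^sup>2)))"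
    using * kappa_pos by (simp add: field_simps)
  finally show ?thesis
    by (simp add: lorentz_inner_eq s_def t_def power2_eq_square mult.assoc)
qed

lemma tangent_nonneg:
  assumes "p \<in> hyp_space \<kappa>" "lorentz_inner p v = 0"
  shows "lorentz_inner v v \<ge> 0"
proof -
  have "0 \<le> 2 * \<kappa> * (snd p)\<^sup>2 * lorentz_inner v v"
    using norm_tangent_le[OF assms] zero_le_power2 order_trans by blast
  then show ?thesis
    using kappa_pos hyp_spaceD(2)[OF assms(1)]
    by (metis mult_pos_pos zero_less_numeral zero_less_power zero_le_mult_iff not_le)
qed

lemma tangent_eq_0:
  assumes "p \<in> hyp_space \<kappa>" "lorentz_inner p v = 0" "lorentz_inner v v = 0"
  shows "v = 0"
  using norm_tangent_le[OF assms(1,2)] assms(3) by simp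

text \<open>The usual argument works because the part \<open>u\<close> of \<open>v\<close>
  orthogonal to \<open>w\<close> stays in the tangent space, where the form is positive
  definite.\<close>

lemma tangent_Cauchy_Schwarz:
  assumes p: "p \<in> hyp_space \<kappa>" and v: "lorentz_inner p v = 0" and w: "lorentz_inner p w = 0"
  shows "\<bar>lorentz_inner v w\<bar> \<le> lorentz_norm v * lorentz_norm w"
proof -
  have "(lorentz_inner v w)\<^sup>2 \<le> lorentz_inner v v * lorentz_inner w w"
  proof (cases "lorentz_inner w w = 0")
    case True
    then show ?thesis using tangent_eq_0[OF p w] by (simp add: lorentz.zero_right)
  next
    case False
    then have ww: "lorentz_inner w w > 0" using tangent_nonneg[OF p w] by simp
    define u where "u = v - (lorentz_inner v w / lorentz_inner w w) *\<^sub>R w"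
    have "0 \<le> lorentz_inner u u"
      by (rule tangent_nonneg[OF p]) (simp add: u_def lorentz_simps v w)
    also have "lorentz_inner u u = lorentz_inner v v - (lorentz_inner v w)\<^sup>2 / lorentz_inner w w"
      using False by (simp add: u_def lorentz_simps lorentz_inner_commute[of w v] field_simps power2_eq_square)
    finally show ?thesis using ww by (simp add: field_simps)
  qed
  then have "sqrt ((lorentz_inner v w)\<^sup>2) \<le> sqrt (lorentz_inner v v * lorentz_inner w w)"
    by (rule real_sqrt_le_mono)
  then show ?thesis by (simp add: lorentz_norm_def real_sqrt_mult)
qed

text \<open>Points of the hyperboloid lie inside the upper light cone,
  \<open>norm (fst x) < snd x\<close>, so the product of the last coordinates dominates the spatial
  product.\<close>

lemma hyp_inner_neg:
  assumes p: "p \<in> hyp_space \<kappa>" and q: "q \<in> hyp_space \<kappa>"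
  shows "lorentz_inner p q < 0"
proof -
  have lt: "norm (fst x) < snd x" if "x \<in> hyp_space \<kappa>" for x :: "'a lorentz"
  proof (rule power2_less_imp_less)
    have "1 / \<kappa> > 0" using kappa_pos by simp
    moreover have "(norm (fst x))\<^sup>2 = (snd x)\<^sup>2 - 1 / \<kappa>"
      using hyp_spaceD(1)[OF that] unfolding power2_norm_eq_inner
      by (simp add: lorentz_inner_eq power2_eq_square)
    ultimately show "(norm (fst x))\<^sup>2 < (snd x)\<^sup>2" by linarith
  qed (use hyp_spaceD(2)[OF that] in simp)
  have "fst p \<bullet> fst q \<le> norm (fst p) * norm (fst q)" by (rule norm_cauchy_schwarz)
  also have "\<dots> < snd p * snd q"
    using lt[OF p] lt[OF q] by (intro mult_strict_mono') auto
  finally show ?thesis by (simp add: lorentz_inner_eq)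
qed

text \<open>Identifies the upper sheet by one product with a known point: on the lower sheet,
  \<open>- x\<close> would belong to the hyperboloid and have a positive product with
  \<open>p\<close>.\<close>

lemma hyp_spaceI:
  assumes p: "p \<in> hyp_space \<kappa>" and "lorentz_inner x x = - 1 / \<kappa>" "lorentz_inner p x < 0"
  shows "x \<in> hyp_space \<kappa>"
proof (rule ccontr)
  assume "x \<notin> hyp_space \<kappa>"
  then have "snd x \<le> 0" using assms(2) by (auto simp: hyp_space_def)
  moreover have "snd x \<noteq> 0"
  proof
    assume "snd x = 0"
    then have "lorentz_inner x x \<ge> 0" by (simp add: lorentz_inner_eq)
    moreover have "- 1 / \<kappa> < 0" using kappa_pos by simp
    ultimately show False using assms(2) by simp
  qed
  ultimately have "- x \<in> hyp_space \<kappa>"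
    using assms(2) by (simp add: hyp_space_def lorentz_simps)
  from hyp_inner_neg[OF p this] assms(3) show False by (simp add: lorentz_simps)
qed

text \<open>\<open>u q\<close> is the tangential part of \<open>q\<close> at \<open>p\<close>, which
  points along the geodesic from \<open>p\<close> to \<open>q\<close>. As
  \<open>- \<kappa> * lorentz_inner p q\<close> is the cosh of the scaled distance, its squared
  length is the squared sinh over \<kappa>.\<close>

lemma tangent_component:
  assumes p: "p \<in> hyp_space \<kappa>"
  defines "u \<equiv> \<lambda>q. q + (\<kappa> * lorentz_inner p q) *\<^sub>R p"
  shows "lorentz_inner p (u q) = 0"
    and "q \<in> hyp_space \<kappa> \<Longrightarrow> lorentz_inner (u q) (u q) = ((- \<kappa> * lorentz_inner p q)\<^sup>2 - 1) / \<kappa>"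
    and "q \<in> hyp_space \<kappa> \<Longrightarrow> (norm (u q))\<^sup>2 \<le> 2 * (snd p)\<^sup>2 * ((- \<kappa> * lorentz_inner p q)\<^sup>2 - 1)"
proof -
  show pu: "lorentz_inner p (u q) = 0"
    using kappa_pos by (simp add: u_def lorentz_simps hyp_spaceD[OF p])
  assume q: "q \<in> hyp_space \<kappa>"
  show uu: "lorentz_inner (u q) (u q) = ((- \<kappa> * lorentz_inner p q)\<^sup>2 - 1) / \<kappa>"
    using kappa_pos by (simp add: u_def lorentz_simps hyp_spaceD[OF p] hyp_spaceD[OF q]
        lorentz_inner_commute[of q p] field_simps power2_eq_square)
  show "(norm (u q))\<^sup>2 \<le> 2 * (snd p)\<^sup>2 * ((- \<kappa> * lorentz_inner p q)\<^sup>2 - 1)"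
    using norm_tangent_le[OF p pu] kappa_pos by (simp add: uu mult.assoc)
qed

text \<open>The reversed Cauchy-Schwarz inequality with its equality case, read off from the squared
  length of the tangential part. It keeps \<open>arcosh\<close> inside its domain.\<close>

lemma hyp_inner_ge_1:
  assumes p: "p \<in> hyp_space \<kappa>" and q: "q \<in> hyp_space \<kappa>"
  shows "1 \<le> - \<kappa> * lorentz_inner p q"
    and "- \<kappa> * lorentz_inner p q = 1 \<Longrightarrow> q = p"
proof -
  define u where "u = q + (\<kappa> * lorentz_inner p q) *\<^sub>R p"
  note pu = tangent_component(1)[OF p, of q, folded u_def]
  note uu = tangent_component(2)[OF p q, folded u_def]
  with tangent_nonneg[OF p pu] have "1 \<le> (- \<kappa> * lorentz_inner p q)\<^sup>2"
    using kappa_pos by (simp add: zero_le_divide_iff)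
  moreover have "0 < - \<kappa> * lorentz_inner p q"
    using hyp_inner_neg[OF p q] kappa_pos by (simp add: mult_pos_neg)
  ultimately show "1 \<le> - \<kappa> * lorentz_inner p q"
    by (metis abs_of_pos abs_1 abs_le_square_iff one_power2)
  show "q = p" if "- \<kappa> * lorentz_inner p q = 1"
  proof -
    have "u = 0" using tangent_eq_0[OF p pu] uu that by simp
    moreover have "\<kappa> * lorentz_inner p q = - 1" using that by simp
    ultimately show ?thesis by (simp add: u_def)
  qed
qed

section \<open>Distance, exponential map and logarithm\<close>

lemma cosh_hdist:
  assumes p: "p \<in> hyp_space \<kappa>" and q: "q \<in> hyp_space \<kappa>"
  shows "cosh (sqrt \<kappa> * hdist \<kappa> p q) = - \<kappa> * lorentz_inner p q"
  using hyp_inner_ge_1[OF assms] kappa_pos by (simp add: hdist_def)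

lemma hdist_eq_0:
  assumes p: "p \<in> hyp_space \<kappa>"
  shows "hdist \<kappa> p p = 0"
  using kappa_pos by (simp add: hdist_def hyp_spaceD[OF p])

lemma hdist_pos:
  assumes p: "p \<in> hyp_space \<kappa>" and q: "q \<in> hyp_space \<kappa>" and "q \<noteq> p"
  shows "hdist \<kappa> p q > 0"
proof -
  have "arcosh (- \<kappa> * lorentz_inner p q) > 0"
    by (subst arcosh_real_gt_1_iff) (use hyp_inner_ge_1[OF p q] assms(3) in auto)
  then show ?thesis using kappa_pos by (simp add: hdist_def)
qed

lemma hdist_less_iff:
  assumes "p \<in> hyp_space \<kappa>" "q \<in> hyp_space \<kappa>" "r \<in> hyp_space \<kappa>"
  shows "hdist \<kappa> p q < hdist \<kappa> p r \<longleftrightarrow> lorentz_inner p r < lorentz_inner p q"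
proof -
  have "hdist \<kappa> p q < hdist \<kappa> p r \<longleftrightarrow> - \<kappa> * lorentz_inner p q < - \<kappa> * lorentz_inner p r"
    unfolding hdist_def
    using arcosh_less_iff_real[OF hyp_inner_ge_1(1)[OF assms(1,2)] hyp_inner_ge_1(1)[OF assms(1,3)]]
      kappa_pos by (simp add: mult_less_cancel_left_pos divide_less_cancel)
  then show ?thesis using kappa_pos by simp
qed

text \<open>Normalising \<open>w\<close> to squared length \<open>1 / \<kappa>\<close> absorbs the
  factors \<open>sqrt \<kappa>\<close> and the case distinction at 0. Negative \<open>s\<close> is
  covered because sinh is odd.\<close>

lemma hexp_unit:
  assumes "lorentz_inner w w = 1 / \<kappa>"
  shows "hexp \<kappa> p (s *\<^sub>R w) = cosh s *\<^sub>R p + sinh s *\<^sub>R w"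
proof (cases "s = 0")
  case False
  have "w \<noteq> 0" using assms kappa_pos by (auto simp: lorentz.zero_right)
  moreover have "sqrt \<kappa> * lorentz_norm (s *\<^sub>R w) = \<bar>s\<bar>"
    using kappa_pos by (simp add: lorentz_norm_def lorentz_simps assms real_sqrt_mult real_sqrt_divide)
  ultimately show ?thesis using False by (auto simp: hexp_def abs_if)
qed (simp add: hexp_def)

lemma hexp_unit_in:
  assumes p: "p \<in> hyp_space \<kappa>" and "lorentz_inner p w = 0" "lorentz_inner w w = 1 / \<kappa>"
  shows "cosh s *\<^sub>R p + sinh s *\<^sub>R w \<in> hyp_space \<kappa>"
proof (rule hyp_spaceI[OF p])
  show "lorentz_inner (cosh s *\<^sub>R p + sinh s *\<^sub>R w) (cosh s *\<^sub>R p + sinh s *\<^sub>R w) = - 1 / \<kappa>"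
    using cosh_square_eq[of s] kappa_pos
    by (simp add: lorentz_simps assms lorentz_inner_commute[of w p] hyp_spaceD[OF p]
        field_simps power2_eq_square)
  show "lorentz_inner p (cosh s *\<^sub>R p + sinh s *\<^sub>R w) < 0"
    using kappa_pos by (simp add: lorentz_simps assms hyp_spaceD[OF p])
qed

text \<open>Polar coordinates of \<open>q\<close> at \<open>p\<close>: the direction
  \<open>w\<close> is the tangential part of \<open>q\<close> divided by the sinh of the scaled
  distance.\<close>

lemma hlog_unit:
  assumes p: "p \<in> hyp_space \<kappa>" and q: "q \<in> hyp_space \<kappa>" and "q \<noteq> p"
  obtains w where "lorentz_inner p w = 0" "lorentz_inner w w = 1 / \<kappa>"
    and "q = cosh (sqrt \<kappa> * hdist \<kappa> p q) *\<^sub>R p + sinh (sqrt \<kappa> * hdist \<kappa> p q) *\<^sub>R w"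
    and "hlog \<kappa> p q = (sqrt \<kappa> * hdist \<kappa> p q) *\<^sub>R w"
proof -
  define \<theta> where "\<theta> = sqrt \<kappa> * hdist \<kappa> p q"
  define u where "u = q + (\<kappa> * lorentz_inner p q) *\<^sub>R p"
  have \<theta>: "\<theta> > 0" using hdist_pos[OF assms] kappa_pos by (simp add: \<theta>_def)
  then have sh: "sinh \<theta> > 0" by simp
  have kB: "\<kappa> * lorentz_inner p q = - cosh \<theta>" using cosh_hdist[OF p q] by (simp add: \<theta>_def)
  note pu = tangent_component(1)[OF p, of q, folded u_def]
  have uu: "lorentz_inner u u = (sinh \<theta>)\<^sup>2 / \<kappa>"
    using tangent_component(2)[OF p q, folded u_def] by (simp add: kB sinh_square_eq)
  then have nu: "lorentz_norm u = sinh \<theta> / sqrt \<kappa>"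
    using sh by (simp add: lorentz_norm_def real_sqrt_divide)
  show thesis
  proof (rule that[of "(1 / sinh \<theta>) *\<^sub>R u"])
    show "lorentz_inner p ((1 / sinh \<theta>) *\<^sub>R u) = 0" by (simp add: lorentz_simps pu)
    show "lorentz_inner ((1 / sinh \<theta>) *\<^sub>R u) ((1 / sinh \<theta>) *\<^sub>R u) = 1 / \<kappa>"
      using sh by (simp add: lorentz_simps uu power2_eq_square)
    show "q = cosh (sqrt \<kappa> * hdist \<kappa> p q) *\<^sub>R p + sinh (sqrt \<kappa> * hdist \<kappa> p q) *\<^sub>R ((1 / sinh \<theta>) *\<^sub>R u)"
      using sh unfolding \<theta>_def[symmetric] by (simp add: u_def kB)
    show "hlog \<kappa> p q = (sqrt \<kappa> * hdist \<kappa> p q) *\<^sub>R ((1 / sinh \<theta>) *\<^sub>R u)"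
      using \<open>q \<noteq> p\<close> kappa_pos by (simp add: hlog_def Let_def nu flip: u_def)
  qed
qed

lemma hyp_convex_unit:
  assumes C: "hyp_convex \<kappa> C" and "p \<in> C" "q \<in> C" "q \<noteq> p"
  obtains w where "lorentz_inner p w = 0" "lorentz_inner w w = 1 / \<kappa>"
    and "q = cosh (sqrt \<kappa> * hdist \<kappa> p q) *\<^sub>R p + sinh (sqrt \<kappa> * hdist \<kappa> p q) *\<^sub>R w"
    and "hlog \<kappa> p q = (sqrt \<kappa> * hdist \<kappa> p q) *\<^sub>R w"
    and "\<And>t. t \<in> {0..1} \<Longrightarrow> cosh (t * (sqrt \<kappa> * hdist \<kappa> p q)) *\<^sub>R p +
            sinh (t * (sqrt \<kappa> * hdist \<kappa> p q)) *\<^sub>R w \<in> C"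
proof -
  have H: "p \<in> hyp_space \<kappa>" "q \<in> hyp_space \<kappa>" using assms by (auto simp: hyp_convex_def)
  from hlog_unit[OF this \<open>q \<noteq> p\<close>] obtain w where w: "lorentz_inner p w = 0" "lorentz_inner w w = 1 / \<kappa>"
    "q = cosh (sqrt \<kappa> * hdist \<kappa> p q) *\<^sub>R p + sinh (sqrt \<kappa> * hdist \<kappa> p q) *\<^sub>R w"
    "hlog \<kappa> p q = (sqrt \<kappa> * hdist \<kappa> p q) *\<^sub>R w" .
  have "hexp \<kappa> p (t *\<^sub>R hlog \<kappa> p q) \<in> C" if "t \<in> {0..1}" for t
    using assms that by (auto simp: hyp_convex_def geodesic_segment_def image_subset_iff)
  with w that show thesis by (simp add: hexp_unit[OF w(2)])
qed

lemma tangent_unit: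
  assumes p: "p \<in> hyp_space \<kappa>" and v: "lorentz_inner p v = 0" and "v \<noteq> 0"
  obtains w where "lorentz_inner p w = 0" "lorentz_inner w w = 1 / \<kappa>"
    and "v = (sqrt \<kappa> * lorentz_norm v) *\<^sub>R w" "lorentz_norm v > 0"
proof -
  have "lorentz_inner v v > 0"
    using tangent_nonneg[OF p v] tangent_eq_0[OF p v] \<open>v \<noteq> 0\<close> by fastforce
  then have n: "lorentz_norm v > 0" "(lorentz_norm v)\<^sup>2 = lorentz_inner v v"
    by (simp_all add: lorentz_norm_def)
  show thesis
  proof (rule that[of "(1 / (sqrt \<kappa> * lorentz_norm v)) *\<^sub>R v"])
    show "lorentz_inner ((1 / (sqrt \<kappa> * lorentz_norm v)) *\<^sub>R v)
        ((1 / (sqrt \<kappa> * lorentz_norm v)) *\<^sub>R v) = 1 / \<kappa>"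
      using n(1) kappa_pos by (simp add: lorentz_simps n(2)[symmetric] field_simps power2_eq_square)
  qed (use n v kappa_pos in \<open>simp_all add: lorentz_simps\<close>)
qed

section \<open>Derivatives along geodesics and the Riemannian gradient\<close>

text \<open>The derivative of \<open>f\<close> is given only within the hyperboloid. The geodesic
  never leaves it, so the chain rule within the range of the curve yields an unrestricted derivative
  in \<open>t\<close>.\<close>

lemma geodesic_has_derivative:
  assumes p: "p \<in> hyp_space \<kappa>" and w: "lorentz_inner p w = 0" "lorentz_inner w w = 1 / \<kappa>"
    and f: "(f has_derivative D) (at (cosh (t * \<theta>) *\<^sub>R p + sinh (t * \<theta>) *\<^sub>R w) within hyp_space \<kappa>)"
  shows "((\<lambda>t. f (cosh (t * \<theta>) *\<^sub>R p + sinh (t * \<theta>) *\<^sub>R w)) has_real_derivative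
           D (\<theta> *\<^sub>R (sinh (t * \<theta>) *\<^sub>R p + cosh (t * \<theta>) *\<^sub>R w))) (at t)"
proof -
  define \<gamma> where "\<gamma> = (\<lambda>t. cosh (t * \<theta>) *\<^sub>R p + sinh (t * \<theta>) *\<^sub>R w)"
  define v where "v = \<theta> *\<^sub>R (sinh (t * \<theta>) *\<^sub>R p + cosh (t * \<theta>) *\<^sub>R w)"
  have "range \<gamma> \<subseteq> hyp_space \<kappa>" using hexp_unit_in[OF p w] by (auto simp: \<gamma>_def)
  with f have "(f has_derivative D) (at (\<gamma> t) within range \<gamma>)"
    unfolding \<gamma>_def by (rule has_derivative_subset)
  moreover have "(\<gamma> has_derivative (\<lambda>h. h *\<^sub>R v)) (at t)"
    unfolding \<gamma>_def v_def
    by (auto intro!: derivative_eq_intros simp: fun_eq_iff algebra_simps)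
  ultimately have "((\<lambda>t. f (\<gamma> t)) has_derivative (\<lambda>h. D (h *\<^sub>R v))) (at t)"
    by (rule has_derivative_in_compose[rotated])
  moreover have "D (h *\<^sub>R v) = D v * h" for h
    using has_derivative_linear[OF f] by (simp add: linear_scale mult.commute)
  ultimately show ?thesis
    by (simp add: has_field_derivative_def \<gamma>_def v_def)
qed

text \<open>Derivatives within the hyperboloid may differ off the tangent space. A tangent vector,
  however, is a multiple of the velocity of a geodesic, along which the one-variable derivative is
  unique.\<close>

lemma tangent_derivative_unique:
  assumes p: "p \<in> hyp_space \<kappa>" and v: "lorentz_inner p v = 0"
    and D: "(f has_derivative D) (at p within hyp_space \<kappa>)"
    and D': "(f has_derivative D') (at p within hyp_space \<kappa>)"
  shows "D v = (D' v :: real)"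
proof (cases "v = 0")
  case True
  then show ?thesis using D D' by (simp add: has_derivative_linear linear_0)
next
  case False
  from tangent_unit[OF p v this] obtain w where w: "lorentz_inner p w = 0" "lorentz_inner w w = 1 / \<kappa>"
    "v = (sqrt \<kappa> * lorentz_norm v) *\<^sub>R w" by metis
  have "D w = D' w"
    using geodesic_has_derivative[OF p w(1,2), of f D 0 1] D
      geodesic_has_derivative[OF p w(1,2), of f D' 0 1] D' by (auto intro: DERIV_unique)
  then show ?thesis
    using D D' by (subst (1 2) w(3)) (simp add: has_derivative_linear linear_scale)
qed

text \<open>Justifies the definite description in \<open>hgrad\<close>. Two candidates have a
  tangent difference that is orthogonal to itself, hence zero.\<close>

lemma hgrad:
  assumes f: "f differentiable_on hyp_space \<kappa>" and p: "p \<in> hyp_space \<kappa>"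
  shows "lorentz_inner p (hgrad \<kappa> f p) = 0"
    and "\<exists>D. (f has_derivative D) (at p within hyp_space \<kappa>) \<and>
             (\<forall>v. lorentz_inner p v = 0 \<longrightarrow> D v = lorentz_inner (hgrad \<kappa> f p) v)"
proof -
  let ?P = "\<lambda>g. g \<in> tangent_space p \<and> (\<exists>D. (f has_derivative D) (at p within hyp_space \<kappa>) \<and>
             (\<forall>v\<in>tangent_space p. D v = lorentz_inner g v))"
  obtain D where D: "(f has_derivative D) (at p within hyp_space \<kappa>)"
    using f p by (auto simp: differentiable_on_def differentiable_def)
  \<comment> \<open>The Euclidean gradient, that is, the vector representing
    \<open>D\<close>.\<close>
  define z where "z = adjoint D 1"
  have z: "D v = z \<bullet> v" for v
    using adjoint_works[OF has_derivative_linear[OF D], of v 1] by (simp add: z_def inner_commute)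
  \<comment> \<open>Flipping the sign of the last coordinate makes \<open>z\<close> represent
    \<open>D\<close> for the Lorentzian form; the added multiple of \<open>p\<close> projects to the
    tangent space and is invisible to tangent vectors.\<close>
  define g where "g = (fst z, - snd z) + (\<kappa> * lorentz_inner p (fst z, - snd z)) *\<^sub>R p"
  have "lorentz_inner p g = 0" unfolding g_def by (rule tangent_component[OF p])
  moreover have "D v = lorentz_inner g v" if "lorentz_inner p v = 0" for v
    using that unfolding g_def lorentz_simps
    by (simp add: z inner_prod_def lorentz_inner_eq[of "(fst z, - snd z)"])
  ultimately have g: "?P g" using D by (auto simp: tangent_space_def)
  have "g1 = g2" if "?P g1" "?P g2" for g1 g2
  proof -
    have *: "lorentz_inner p (g1 - g2) = 0"
      using that by (simp add: tangent_space_def lorentz_simps)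
    have mem: "g1 - g2 \<in> tangent_space p" using * by (simp add: tangent_space_def)
    from that obtain D1 D2 where D12: "(f has_derivative D1) (at p within hyp_space \<kappa>)"
      "(f has_derivative D2) (at p within hyp_space \<kappa>)"
      and v12: "\<And>v. v \<in> tangent_space p \<Longrightarrow> D1 v = lorentz_inner g1 v"
      "\<And>v. v \<in> tangent_space p \<Longrightarrow> D2 v = lorentz_inner g2 v"
      by blast
    have "lorentz_inner g1 (g1 - g2) = lorentz_inner g2 (g1 - g2)"
      using tangent_derivative_unique[OF p * D12] unfolding v12(1)[OF mem] v12(2)[OF mem] .
    then have "lorentz_inner (g1 - g2) (g1 - g2) = 0" by (simp add: lorentz_simps)
    with tangent_eq_0[OF p *] show ?thesis by simp
  qed
  with g have "\<exists>!g. ?P g" by blast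
  from theI'[OF this, folded hgrad_def]
  show "lorentz_inner p (hgrad \<kappa> f p) = 0"
    and "\<exists>D. (f has_derivative D) (at p within hyp_space \<kappa>) \<and>
             (\<forall>v. lorentz_inner p v = 0 \<longrightarrow> D v = lorentz_inner (hgrad \<kappa> f p) v)"
    by (simp_all add: tangent_space_def)
qed

section \<open>Projection onto closed convex sets\<close>

text \<open>Along the geodesic from \<open>P\<close> to \<open>x\<close> the product with
  \<open>q\<close> cannot increase initially. The left side is the product of \<open>x\<close> with
  the tangential part of \<open>q\<close> at \<open>P\<close>; this form avoids logarithms and is
  linear in \<open>x\<close>.\<close>

lemma minimizer_variational:
  assumes C: "hyp_convex \<kappa> C" and "P \<in> C" "x \<in> C"
    and max: "\<And>y. y \<in> C \<Longrightarrow> lorentz_inner q y \<le> lorentz_inner q P"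
  shows "lorentz_inner q x + \<kappa> * lorentz_inner P x * lorentz_inner q P \<le> 0"
proof -
  have H: "P \<in> hyp_space \<kappa>" "x \<in> hyp_space \<kappa>" using assms by (auto simp: hyp_convex_def)
  show ?thesis
  proof (cases "x = P")
    case True
    then show ?thesis using kappa_pos by (simp add: hyp_spaceD[OF H(1)])
  next
    case False
    define \<theta> where "\<theta> = sqrt \<kappa> * hdist \<kappa> P x"
    have \<theta>: "\<theta> > 0" using hdist_pos[OF H False] kappa_pos by (simp add: \<theta>_def)
    from hyp_convex_unit[OF C \<open>P \<in> C\<close> \<open>x \<in> C\<close> False] obtain w where
      x: "x = cosh \<theta> *\<^sub>R P + sinh \<theta> *\<^sub>R w"
      and seg: "\<And>t. t \<in> {0..1} \<Longrightarrow> cosh (t * \<theta>) *\<^sub>R P + sinh (t * \<theta>) *\<^sub>R w \<in> C"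
      unfolding \<theta>_def by metis
    define F where "F t = lorentz_inner q (cosh (t * \<theta>) *\<^sub>R P + sinh (t * \<theta>) *\<^sub>R w)" for t
    have "lorentz_inner q w \<le> 0"
    proof (rule ccontr)
      assume "\<not> ?thesis"
      then have "\<theta> * lorentz_inner q w > 0" using \<theta> by simp
      moreover have "(F has_real_derivative \<theta> * lorentz_inner q w) (at 0)"
        unfolding F_def lorentz_simps by (auto intro!: derivative_eq_intros)
      ultimately obtain d where d: "d > 0" "\<And>h. h > 0 \<Longrightarrow> h < d \<Longrightarrow> F 0 < F (0 + h)"
        using DERIV_pos_inc_right by metis
      \<comment> \<open>This parameter is below \<open>d\<close> and still in the unit interval, so
        the curve point lies in \<open>C\<close>.\<close>
      have "F 0 < F (min (d / 2) 1)" using d(1) d(2)[of "min (d / 2) 1"] by simp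
      also have "\<dots> \<le> F 0" using d(1) unfolding F_def by (simp add: max seg)
      finally show False by simp
    qed
    then have "sinh \<theta> * lorentz_inner q w \<le> 0" using \<theta> by (simp add: mult_le_0_iff)
    then have "lorentz_inner q x - cosh \<theta> * lorentz_inner q P \<le> 0"
      by (simp add: x lorentz_simps)
    then show ?thesis using cosh_hdist[OF H, folded \<theta>_def] by simp
  qed
qed

text \<open>Justifies the definite description in \<open>hproj\<close>: existence comes from
  compactness of a superlevel set, uniqueness from the variational inequality.\<close>

lemma hproj:
  assumes closed: "closedin (top_of_set (hyp_space \<kappa>)) C" and C: "hyp_convex \<kappa> C"
    and "C \<noteq> {}" and q: "q \<in> hyp_space \<kappa>"
  shows "hproj \<kappa> C q \<in> C"
    and "x \<in> C \<Longrightarrow>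
      lorentz_inner q x + \<kappa> * lorentz_inner (hproj \<kappa> C q) x * lorentz_inner q (hproj \<kappa> C q) \<le> 0"
proof -
  have CH: "x \<in> hyp_space \<kappa>" if "x \<in> C" for x using C that by (auto simp: hyp_convex_def)
  have cl: "closed C" using closed closed_hyp_space closedin_closed_trans by blast
  \<comment> \<open>The distance from \<open>q\<close> decreases as the product with
    \<open>q\<close> grows, so projecting means maximising a linear functional.\<close>
  have argmin: "is_arg_min (hdist \<kappa> q) (\<lambda>q. q \<in> C) P \<longleftrightarrow>
      P \<in> C \<and> (\<forall>y\<in>C. lorentz_inner q y \<le> lorentz_inner q P)" for P
    unfolding is_arg_min_def by (metis hdist_less_iff[OF q CH CH] not_less)
  obtain c where c: "c \<in> C" using \<open>C \<noteq> {}\<close> by blast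
  \<comment> \<open>The points of \<open>C\<close> no farther from \<open>q\<close> than
    \<open>c\<close>; \<open>C\<close> itself may be unbounded.\<close>
  define K where "K = C \<inter> {x. lorentz_inner q c \<le> lorentz_inner q x}"
  have cont: "continuous_on S (lorentz_inner q)" for S
    by (intro lorentz.continuous_on continuous_intros)
  have "closed K"
    unfolding K_def by (intro closed_Int cl closed_Collect_le cont continuous_intros)
  moreover have "bounded K"
  proof (rule boundedI)
    fix x assume "x \<in> K"
    then have x: "x \<in> hyp_space \<kappa>" and le: "lorentz_inner q c \<le> lorentz_inner q x"
      by (auto simp: K_def CH)
    define M m where "M = - \<kappa> * lorentz_inner q c" and "m = - \<kappa> * lorentz_inner q x"
    have m: "1 \<le> m" "m \<le> M"
      using hyp_inner_ge_1[OF q x] le kappa_pos by (simp_all add: M_def m_def)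
    \<comment> \<open>Splitting \<open>x\<close> into its tangential part at \<open>q\<close> and
      the multiple \<open>m\<close> of \<open>q\<close>, both parts are controlled by
      \<open>M\<close>.\<close>
    have "(norm (x + (\<kappa> * lorentz_inner q x) *\<^sub>R q))\<^sup>2 \<le> 2 * (snd q)\<^sup>2 * (m\<^sup>2 - 1)"
      using tangent_component(3)[OF q x] by (simp add: m_def)
    also have "\<dots> \<le> 2 * (snd q)\<^sup>2 * M\<^sup>2"
      using power_mono[OF m(2), of 2] m(1) by (intro mult_left_mono) auto
    finally have "norm (x - m *\<^sub>R q) \<le> sqrt (2 * (snd q)\<^sup>2 * M\<^sup>2)"
      using real_le_rsqrt by (simp add: m_def)
    moreover have "norm x \<le> norm (x - m *\<^sub>R q) + norm (m *\<^sub>R q)"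
      by (metis diff_add_cancel norm_triangle_ineq)
    moreover have "norm (m *\<^sub>R q) \<le> M * norm q"
      using m by (simp add: mult_right_mono)
    ultimately show "norm x \<le> sqrt (2 * (snd q)\<^sup>2 * M\<^sup>2) + M * norm q" by linarith
  qed
  ultimately have "compact K" by (simp add: compact_eq_bounded_closed)
  moreover have cK: "c \<in> K" using c by (simp add: K_def)
  ultimately obtain P where P: "P \<in> K" "\<And>y. y \<in> K \<Longrightarrow> lorentz_inner q y \<le> lorentz_inner q P"
    using continuous_attains_sup[OF _ _ cont, of K] by blast
  have "lorentz_inner q y \<le> lorentz_inner q P" if "y \<in> C" for y
    using P(2)[of y] P(2)[OF cK] that by (cases "y \<in> K") (auto simp: K_def)
  then have 1: "is_arg_min (hdist \<kappa> q) (\<lambda>q. q \<in> C) P"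
    unfolding argmin using P(1) by (simp add: K_def)
  have 2: "P1 = P2" if "is_arg_min (hdist \<kappa> q) (\<lambda>q. q \<in> C) P1"
    "is_arg_min (hdist \<kappa> q) (\<lambda>q. q \<in> C) P2" for P1 P2
  proof -
    have P12: "P1 \<in> C" "P2 \<in> C" and eq: "lorentz_inner q P2 = lorentz_inner q P1"
      and max: "\<And>y. y \<in> C \<Longrightarrow> lorentz_inner q y \<le> lorentz_inner q P1"
      using that by (auto simp: argmin intro: antisym)
    \<comment> \<open>The inequality at \<open>P1\<close> is tested with \<open>P2\<close>; equal
      products with \<open>q\<close> let it factor. As the first factor is negative,
      \<open>P1\<close> and \<open>P2\<close> fall into the equality case of
      \<open>hyp_inner_ge_1\<close>.\<close>
    have "lorentz_inner q P1 * (1 + \<kappa> * lorentz_inner P1 P2) \<le> 0"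
      using minimizer_variational[OF C P12 max] by (simp add: eq algebra_simps)
    moreover have "lorentz_inner q P1 < 0" using hyp_inner_neg[OF q CH] P12 by blast
    ultimately have "- \<kappa> * lorentz_inner P1 P2 \<le> 1" by (simp add: mult_le_0_iff)
    then show ?thesis using hyp_inner_ge_1[OF CH[OF P12(1)] CH[OF P12(2)]] by fastforce
  qed
  have "is_arg_min (hdist \<kappa> q) (\<lambda>q. q \<in> C) (hproj \<kappa> C q)"
    unfolding hproj_def by (rule theI[of _ P]) (use 1 2 in auto)
  then have *: "hproj \<kappa> C q \<in> C"
    "\<And>y. y \<in> C \<Longrightarrow> lorentz_inner q y \<le> lorentz_inner q (hproj \<kappa> C q)" by (auto simp: argmin)
  from * show "hproj \<kappa> C q \<in> C" by simp
  show "lorentz_inner q x + \<kappa> * lorentz_inner (hproj \<kappa> C q) x * lorentz_inner q (hproj \<kappa> C q) \<le> 0"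
    if "x \<in> C" using minimizer_variational[OF C *(1) that] *(2) by blast
qed

section \<open>Parallel transport and descent estimates\<close>

lemma parallel_transport_tangent:
  assumes p: "p \<in> hyp_space \<kappa>" and q: "q \<in> hyp_space \<kappa>"
  shows "lorentz_inner q (parallel_transport \<kappa> p q v) = 0"
proof -
  define c where "c = \<kappa> * lorentz_inner p q - 1"
  have "c \<noteq> 0" using hyp_inner_ge_1[OF p q] unfolding c_def by linarith
  moreover have "lorentz_inner q (p + q) = c / \<kappa>"
    using kappa_pos by (simp add: c_def lorentz_simps hyp_spaceD[OF q] lorentz_inner_commute[of q p]
        diff_divide_distrib)
  ultimately show ?thesis
    using kappa_pos by (simp add: parallel_transport_def lorentz.diff_right lorentz.scaleR_right
        flip: c_def)
qed

text \<open>Geodesic velocities are parallel and transport is an isometry, so the product with the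
  velocity is preserved. The proof checks this directly for the explicit formula.\<close>

lemma parallel_transport_velocity:
  assumes p: "p \<in> hyp_space \<kappa>" and w: "lorentz_inner p w = 0" "lorentz_inner w w = 1 / \<kappa>"
    and v: "lorentz_inner p v = 0"
  shows "lorentz_inner (parallel_transport \<kappa> p (cosh \<tau> *\<^sub>R p + sinh \<tau> *\<^sub>R w) v)
           (sinh \<tau> *\<^sub>R p + cosh \<tau> *\<^sub>R w) = lorentz_inner v w"
proof -
  define q n where "q = cosh \<tau> *\<^sub>R p + sinh \<tau> *\<^sub>R w" and "n = sinh \<tau> *\<^sub>R p + cosh \<tau> *\<^sub>R w"
  have wp: "lorentz_inner w p = 0" and vp: "lorentz_inner v p = 0"
    using w v by (simp_all add: lorentz_inner_commute)
  \<comment> \<open>Minus the denominator in the transport formula; it cancels because \<open>(sinh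
    \<tau>)\<^sup>2 = (cosh \<tau> - 1) * (cosh \<tau> + 1)\<close>.\<close>
  define e where "e = cosh \<tau> + 1"
  have e: "e > 0" using cosh_real_ge_1[of \<tau>] by (simp add: e_def)
  have "\<kappa> * lorentz_inner p q - 1 = - e"
    using kappa_pos by (simp add: e_def q_def lorentz_simps w hyp_spaceD[OF p])
  moreover have "lorentz_inner q v = sinh \<tau> * lorentz_inner v w"
    by (simp add: q_def lorentz_simps v lorentz_inner_commute)
  moreover have "lorentz_inner v n = cosh \<tau> * lorentz_inner v w"
    by (simp add: n_def lorentz_simps vp)
  moreover have "lorentz_inner (p + q) n = - sinh \<tau> / \<kappa>"
    using kappa_pos by (simp add: n_def q_def lorentz_simps w wp hyp_spaceD[OF p] field_simps)
  ultimately have "lorentz_inner (parallel_transport \<kappa> p q v) n =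
      cosh \<tau> * lorentz_inner v w
      - (\<kappa> * (sinh \<tau> * lorentz_inner v w) / (- e)) * (- sinh \<tau> / \<kappa>)"
    by (simp only: parallel_transport_def lorentz.diff_left lorentz.scaleR_left real_scaleR_def)
  also have "\<dots> = lorentz_inner v w * (cosh \<tau> - (sinh \<tau>)\<^sup>2 / e)"
    using kappa_pos by (simp add: right_diff_distrib power2_eq_square mult_ac)
  also have "(sinh \<tau>)\<^sup>2 / e = cosh \<tau> - 1"
    using e by (simp add: sinh_square_eq nonzero_divide_eq_eq) (simp add: e_def algebra_simps power2_eq_square)
  finally show ?thesis by (simp add: q_def n_def)
qed

text \<open>The mean value theorem at a single point gives the constant \<open>L\<close> instead of
  the \<open>L / 2\<close> of the integral form; the bound on the step size leaves room for this.
  Convexity keeps the intermediate point in \<open>C\<close>, where the Lipschitz condition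
  holds.\<close>

lemma lipschitz_descent:
  assumes f: "f differentiable_on hyp_space \<kappa>" and C: "hyp_convex \<kappa> C"
    and L: "grad_lipschitz_on \<kappa> f C L" "L \<ge> 0" and p: "p \<in> C" and P: "P \<in> C" "P \<noteq> p"
  shows "f P \<le> f p + lorentz_inner (hgrad \<kappa> f p) (hlog \<kappa> p P) + L * (hdist \<kappa> p P)\<^sup>2"
proof -
  have CH: "x \<in> hyp_space \<kappa>" if "x \<in> C" for x using C that by (auto simp: hyp_convex_def)
  define d where "d = hdist \<kappa> p P"
  define \<theta> where "\<theta> = sqrt \<kappa> * hdist \<kappa> p P"
  have d: "d > 0" and \<theta>: "\<theta> > 0" "\<theta> / sqrt \<kappa> = d"
    using hdist_pos[OF CH[OF p] CH P(2)] P(1) kappa_pos by (simp_all add: \<theta>_def d_def)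
  from hyp_convex_unit[OF C p P] obtain w where
    w: "lorentz_inner p w = 0" "lorentz_inner w w = 1 / \<kappa>"
    and Peq: "P = cosh \<theta> *\<^sub>R p + sinh \<theta> *\<^sub>R w" and hlog: "hlog \<kappa> p P = \<theta> *\<^sub>R w"
    and seg: "\<And>t. t \<in> {0..1} \<Longrightarrow> cosh (t * \<theta>) *\<^sub>R p + sinh (t * \<theta>) *\<^sub>R w \<in> C"
    unfolding \<theta>_def by metis
  define \<gamma> \<nu> where "\<gamma> t = cosh (t * \<theta>) *\<^sub>R p + sinh (t * \<theta>) *\<^sub>R w"
    and "\<nu> t = sinh (t * \<theta>) *\<^sub>R p + cosh (t * \<theta>) *\<^sub>R w" for t
  have wp: "lorentz_inner w p = 0" using w by (simp add: lorentz_inner_commute)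
  have \<gamma>\<nu>: "lorentz_inner (\<gamma> t) (\<nu> t) = 0" for t
    by (simp add: \<gamma>_def \<nu>_def lorentz_simps w wp hyp_spaceD[OF CH[OF p]] algebra_simps)
  have "lorentz_inner (\<nu> t) (\<nu> t) = 1 / \<kappa>" for t
    using cosh_square_eq[of "t * \<theta>"] kappa_pos
    by (simp add: \<nu>_def lorentz_simps w wp hyp_spaceD[OF CH[OF p]] field_simps power2_eq_square)
  then have \<nu>: "lorentz_norm (\<nu> t) = 1 / sqrt \<kappa>" for t by (simp add: lorentz_norm_def real_sqrt_divide)
  have "((\<lambda>t. f (\<gamma> t)) has_real_derivative lorentz_inner (hgrad \<kappa> f (\<gamma> t)) (\<theta> *\<^sub>R \<nu> t)) (at t)" for t
  proof -
    have H: "\<gamma> t \<in> hyp_space \<kappa>" unfolding \<gamma>_def by (rule hexp_unit_in[OF CH[OF p] w])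
    from hgrad(2)[OF f H] obtain D where D: "(f has_derivative D) (at (\<gamma> t) within hyp_space \<kappa>)"
      "\<And>v. lorentz_inner (\<gamma> t) v = 0 \<Longrightarrow> D v = lorentz_inner (hgrad \<kappa> f (\<gamma> t)) v" by blast
    have "D (\<theta> *\<^sub>R \<nu> t) = lorentz_inner (hgrad \<kappa> f (\<gamma> t)) (\<theta> *\<^sub>R \<nu> t)"
      by (rule D(2)) (simp add: lorentz_simps \<gamma>\<nu>)
    with geodesic_has_derivative[OF CH[OF p] w D(1)[unfolded \<gamma>_def]] show ?thesis
      by (simp add: \<gamma>_def \<nu>_def)
  qed
  from MVT2[OF zero_less_one this] obtain t where t: "0 < t" "t < 1"
    and mvt: "f (\<gamma> 1) - f (\<gamma> 0) = (1 - 0) * lorentz_inner (hgrad \<kappa> f (\<gamma> t)) (\<theta> *\<^sub>R \<nu> t)"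
    by blast
  define q where "q = \<gamma> t"
  have q: "q \<in> C" unfolding q_def \<gamma>_def using t by (intro seg) simp
  define X where "X = parallel_transport \<kappa> p q (hgrad \<kappa> f p)"
  have "hdist \<kappa> p q = t * d"
  proof -
    have "- \<kappa> * lorentz_inner p q = cosh (t * \<theta>)"
      using kappa_pos by (simp add: q_def \<gamma>_def lorentz_simps w hyp_spaceD[OF CH[OF p]])
    then have "hdist \<kappa> p q = t * \<theta> / sqrt \<kappa>"
      using t \<theta> by (simp add: hdist_def arcosh_cosh_real)
    then show ?thesis using \<theta> by (simp flip: \<theta>(2))
  qed
  then have "lorentz_norm (X - hgrad \<kappa> f q) \<le> L * (t * d)"
    using L(1) p q unfolding grad_lipschitz_on_def X_def by metis
  \<comment> \<open>Removes the unknown intermediate parameter \<open>t\<close>.\<close>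
  also have "\<dots> \<le> L * d" using t d L(2) by (intro mult_left_mono) (simp_all add: mult_left_le_one_le)
  finally have lip: "lorentz_norm (X - hgrad \<kappa> f q) \<le> L * d" .
  have "lorentz_inner q (X - hgrad \<kappa> f q) = 0"
    using parallel_transport_tangent[OF CH[OF p] CH[OF q]] hgrad(1)[OF f CH[OF q]]
    by (simp add: X_def lorentz_simps)
  from tangent_Cauchy_Schwarz[OF CH[OF q] this, of "\<nu> t"]
  have "\<bar>lorentz_inner (X - hgrad \<kappa> f q) (\<nu> t)\<bar> \<le> lorentz_norm (X - hgrad \<kappa> f q) / sqrt \<kappa>"
    by (simp add: \<nu> \<gamma>\<nu> q_def)
  also have "\<dots> \<le> L * d / sqrt \<kappa>" using lip kappa_pos by (simp add: divide_right_mono)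
  finally have "lorentz_inner (hgrad \<kappa> f q) (\<nu> t) \<le> lorentz_inner X (\<nu> t) + L * d / sqrt \<kappa>"
    by (simp add: lorentz_simps)
  also have "lorentz_inner X (\<nu> t) = lorentz_inner (hgrad \<kappa> f p) w"
    unfolding X_def q_def \<gamma>_def \<nu>_def
    by (rule parallel_transport_velocity[OF CH[OF p] w hgrad(1)[OF f CH[OF p]]])
  finally have "\<theta> * lorentz_inner (hgrad \<kappa> f q) (\<nu> t)
      \<le> \<theta> * (lorentz_inner (hgrad \<kappa> f p) w + L * d / sqrt \<kappa>)"
    using \<theta> by (intro mult_left_mono) auto
  also have "\<dots> = \<theta> * lorentz_inner (hgrad \<kappa> f p) w + L * d * (\<theta> / sqrt \<kappa>)"
    by (simp add: algebra_simps)
  also have "\<dots> = lorentz_inner (hgrad \<kappa> f p) (hlog \<kappa> p P) + L * d\<^sup>2"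
    by (simp add: \<theta>(2) hlog lorentz_simps power2_eq_square)
  finally show ?thesis
    using mvt by (simp add: q_def lorentz_simps d_def) (simp add: \<gamma>_def Peq[symmetric])
qed

text \<open>Collects what one iteration provides: feasibility, decrease of the objective, and the
  variational inequality, which is kept for the passage to the limit.\<close>

lemma projected_step_decrease:
  assumes f: "f differentiable_on hyp_space \<kappa>"
    and closed: "closedin (top_of_set (hyp_space \<kappa>)) C" and C: "hyp_convex \<kappa> C"
    and L: "grad_lipschitz_on \<kappa> f C L" "L \<ge> 0" and p: "p \<in> C" and "\<alpha> > 0"
    and g: "hgrad \<kappa> f p \<noteq> 0"
  defines "q \<equiv> hexp \<kappa> p (- \<alpha> *\<^sub>R hgrad \<kappa> f p)"
  defines "P \<equiv> hproj \<kappa> C q"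
  shows "P \<in> C" and "f P \<le> f p - (1 / \<alpha> - L) * (hdist \<kappa> p P)\<^sup>2"
    and "x \<in> C \<Longrightarrow> lorentz_inner q x + \<kappa> * lorentz_inner P x * lorentz_inner q P \<le> 0"
proof -
  have CH: "x \<in> hyp_space \<kappa>" if "x \<in> C" for x using C that by (auto simp: hyp_convex_def)
  note pH = CH[OF p]
  define c where "c = \<alpha> * (sqrt \<kappa> * lorentz_norm (hgrad \<kappa> f p))"
  from tangent_unit[OF pH hgrad(1)[OF f pH] g] obtain w where
    w: "lorentz_inner p w = 0" "lorentz_inner w w = 1 / \<kappa>"
    and gw: "hgrad \<kappa> f p = (sqrt \<kappa> * lorentz_norm (hgrad \<kappa> f p)) *\<^sub>R w"
    and n: "lorentz_norm (hgrad \<kappa> f p) > 0" by metis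
  have c: "c > 0" using n kappa_pos \<open>\<alpha> > 0\<close> by (simp add: c_def)
  \<comment> \<open>\<open>w\<close> points along the gradient, so the unprojected point has
    parameter \<open>- c\<close>, where \<open>c\<close> is its scaled distance from
    \<open>p\<close>.\<close>
  have "- \<alpha> *\<^sub>R hgrad \<kappa> f p = (- c) *\<^sub>R w" by (subst gw) (simp add: c_def)
  then have q: "q = cosh (- c) *\<^sub>R p + sinh (- c) *\<^sub>R w"
    unfolding q_def by (metis hexp_unit[OF w(2)])
  have qH: "q \<in> hyp_space \<kappa>" unfolding q by (rule hexp_unit_in[OF pH w])
  have ne: "C \<noteq> {}" using p by blast
  show PC: "P \<in> C" unfolding P_def by (rule hproj[OF closed C ne qH])
  show var: "lorentz_inner q x + \<kappa> * lorentz_inner P x * lorentz_inner q P \<le> 0" if "x \<in> C" for x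
    unfolding P_def by (rule hproj(2)[OF closed C ne qH that])
  show "f P \<le> f p - (1 / \<alpha> - L) * (hdist \<kappa> p P)\<^sup>2"
  proof (cases "P = p")
    case True
    then show ?thesis by (simp add: hdist_eq_0[OF pH])
  next
    case False
    define d a where "d = hdist \<kappa> p P" and "a = sqrt \<kappa> * hdist \<kappa> p P"
    have a: "a > 0" "a\<^sup>2 = \<kappa> * d\<^sup>2"
      using hdist_pos[OF pH CH[OF PC] False] kappa_pos by (simp_all add: a_def d_def power_mult_distrib)
    from hlog_unit[OF pH CH[OF PC] False] obtain v where
      v: "lorentz_inner p v = 0" "lorentz_inner v v = 1 / \<kappa>"
      and P: "P = cosh a *\<^sub>R p + sinh a *\<^sub>R v" and hlog: "hlog \<kappa> p P = a *\<^sub>R v"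
      unfolding a_def by metis
    \<comment> \<open>The cosine of the angle at \<open>p\<close> between the directions
      \<open>- w\<close> to \<open>q\<close> and \<open>v\<close> to \<open>P\<close>.\<close>
    define b where "b = - \<kappa> * lorentz_inner w v"
    have "\<bar>lorentz_inner w v\<bar> \<le> 1 / \<kappa>"
      using tangent_Cauchy_Schwarz[OF pH w(1) v(1)] kappa_pos
      by (simp add: lorentz_norm_def w v flip: real_sqrt_mult)
    then have b: "b \<le> 1" using kappa_pos by (simp add: b_def field_simps abs_le_iff)
    have wp: "lorentz_inner w p = 0" and vp: "lorentz_inner v p = 0"
      using w v by (simp_all add: lorentz_inner_commute)
    have 1: "\<kappa> * lorentz_inner q p = - cosh c"
      using kappa_pos by (simp add: q lorentz_simps wp hyp_spaceD[OF pH])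
    have 2: "\<kappa> * lorentz_inner P p = - cosh a"
      using kappa_pos by (simp add: P lorentz_simps vp hyp_spaceD[OF pH])
    have 3: "\<kappa> * lorentz_inner q P = - cosh c * cosh a + sinh c * sinh a * b"
      using kappa_pos by (simp add: q P lorentz_simps wp v hyp_spaceD[OF pH] b_def algebra_simps)
    \<comment> \<open>Testing the variational inequality with \<open>p\<close> itself says that the
      angle at \<open>P\<close> is not acute. After division by \<open>sinh a\<close> it is the
      hypothesis of \<open>obtuse_triangle\<close>.\<close>
    have "\<kappa> * (lorentz_inner q p + \<kappa> * lorentz_inner P p * lorentz_inner q P) \<le> 0"
      using var[OF p] kappa_pos by (simp add: mult_le_0_iff)
    also have "\<kappa> * (lorentz_inner q p + \<kappa> * lorentz_inner P p * lorentz_inner q P)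
        = \<kappa> * lorentz_inner q p + (\<kappa> * lorentz_inner P p) * (\<kappa> * lorentz_inner q P)"
      by (simp add: algebra_simps)
    also have "\<dots> = cosh c * ((cosh a)\<^sup>2 - 1) - sinh a * (cosh a * sinh c * b)"
      unfolding 1 2 3 by (simp add: algebra_simps power2_eq_square)
    also have "\<dots> = sinh a * (cosh c * sinh a - cosh a * sinh c * b)"
      unfolding cosh_square_eq by (simp add: algebra_simps power2_eq_square)
    finally have "cosh c * sinh a \<le> cosh a * sinh c * b"
      using a(1) by (simp add: mult_le_0_iff)
    from obtuse_triangle[OF a(1) c b this] have "a * a \<le> a * (c * b)"
      using a(1) by (intro mult_left_mono) auto
    then have "a\<^sup>2 \<le> \<kappa> * (- a * c * lorentz_inner w v)"
      by (simp add: b_def power2_eq_square mult_ac)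
    then have "\<kappa> * d\<^sup>2 \<le> \<kappa> * (- a * c * lorentz_inner w v)" unfolding a(2) .
    then have d: "d\<^sup>2 \<le> - a * c * lorentz_inner w v"
      using kappa_pos by (simp only: mult_le_cancel_left_pos)
    \<comment> \<open>The gradient is \<open>c / \<alpha>\<close> times \<open>w\<close> and the
      logarithm is \<open>a\<close> times \<open>v\<close>.\<close>
    have "lorentz_inner (hgrad \<kappa> f p) (hlog \<kappa> p P) = (a * c * lorentz_inner w v) / \<alpha>"
      using \<open>\<alpha> > 0\<close> by (subst gw) (simp add: hlog lorentz_simps c_def)
    also have "\<dots> \<le> - d\<^sup>2 / \<alpha>" using d \<open>\<alpha> > 0\<close> by (intro divide_right_mono) auto
    finally show ?thesis
      using lipschitz_descent[OF f C L p PC False] by (simp add: d_def algebra_simps)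
  qed
qed

section \<open>Limits of points, gradients and exponentials\<close>

text \<open>The tangential part of \<open>Y k\<close> at \<open>X k\<close> has Euclidean norm
  controlled by the distance and the height \<open>snd (X k)\<close>, and the heights converge along
  with \<open>X\<close>. The remaining coefficient \<open>m k\<close> is a cosh tending to
  1.\<close>

lemma tendsto_hdist_0:
  assumes X: "\<And>k::nat. X k \<in> hyp_space \<kappa>" and Y: "\<And>k. Y k \<in> hyp_space \<kappa>"
    and lim: "X \<longlonglongrightarrow> x" and d: "(\<lambda>k. hdist \<kappa> (X k) (Y k)) \<longlonglongrightarrow> 0"
  shows "Y \<longlonglongrightarrow> x"
proof -
  define m u where "m k = - \<kappa> * lorentz_inner (X k) (Y k)" and "u k = Y k - m k *\<^sub>R X k" for k
  have "(\<lambda>k. cosh (sqrt \<kappa> * hdist \<kappa> (X k) (Y k))) \<longlonglongrightarrow> cosh (sqrt \<kappa> * 0)"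
    by (intro tendsto_intros d)
  then have m: "m \<longlonglongrightarrow> 1" by (simp add: m_def[abs_def] cosh_hdist[OF X Y])
  have le: "(norm (u k))\<^sup>2 \<le> 2 * (snd (X k))\<^sup>2 * ((m k)\<^sup>2 - 1)" for k
    using tangent_component(3)[OF X Y, of k k] by (simp add: u_def m_def)
  have "(\<lambda>k. 2 * (snd (X k))\<^sup>2 * ((m k)\<^sup>2 - 1)) \<longlonglongrightarrow> 2 * (snd x)\<^sup>2 * (1\<^sup>2 - 1)"
    by (intro tendsto_intros m lim)
  then have lim0: "(\<lambda>k. 2 * (snd (X k))\<^sup>2 * ((m k)\<^sup>2 - 1)) \<longlonglongrightarrow> 0" by simp
  have "(\<lambda>k. (norm (u k))\<^sup>2) \<longlonglongrightarrow> 0"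
    by (rule Lim_null_comparison[OF _ lim0]) (simp add: le)
  then have u: "u \<longlonglongrightarrow> 0" by (simp add: tendsto_norm_zero_iff)
  have "(\<lambda>k. u k + m k *\<^sub>R X k) \<longlonglongrightarrow> 0 + 1 *\<^sub>R x" by (intro tendsto_intros u m lim)
  then show ?thesis by (simp add: u_def)
qed

text \<open>The gradient at \<open>X k\<close> is compared with the gradient at \<open>x\<close>
  transported to \<open>X k\<close>. The Lipschitz condition makes the difference small in Lorentz
  length, \<open>norm_tangent_le\<close> makes it small in Euclidean norm, and the transport tends
  to the identity on tangent vectors.\<close>

lemma tendsto_hgrad:
  assumes f: "f differentiable_on hyp_space \<kappa>" and C: "C \<subseteq> hyp_space \<kappa>"
    and L: "grad_lipschitz_on \<kappa> f C L"
    and X: "\<And>k::nat. X k \<in> C" and x: "x \<in> C" and lim: "X \<longlonglongrightarrow> x"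
  shows "(\<lambda>k. hgrad \<kappa> f (X k)) \<longlonglongrightarrow> hgrad \<kappa> f x"
proof -
  have XH: "X k \<in> hyp_space \<kappa>" and xH: "x \<in> hyp_space \<kappa>" for k using C X x by auto
  define T where "T k = parallel_transport \<kappa> x (X k) (hgrad \<kappa> f x)" for k
  define v where "v k = T k - hgrad \<kappa> f (X k)" for k
  have Xv: "lorentz_inner (X k) (v k) = 0" for k
    using parallel_transport_tangent[OF xH XH] hgrad(1)[OF f XH]
    by (simp add: v_def T_def lorentz_simps)
  have xx: "\<kappa> * lorentz_inner x x = - 1" using kappa_pos by (simp add: hyp_spaceD[OF xH])
  \<comment> \<open>The limit of the arguments is 1, the endpoint of the domain of
    \<open>arcosh\<close>; continuity there is one-sided and uses that all arguments are at least
    1.\<close>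
  have "(\<lambda>k. arcosh (- \<kappa> * lorentz_inner x (X k))) \<longlonglongrightarrow> arcosh (- \<kappa> * lorentz_inner x x)"
    using hyp_inner_ge_1[OF xH XH]
    by (intro tendsto_arcosh_strong tendsto_intros lorentz.tendsto lim) (simp_all add: xx)
  then have "(\<lambda>k. 1 / sqrt \<kappa> * arcosh (- \<kappa> * lorentz_inner x (X k))) \<longlonglongrightarrow> 1 / sqrt \<kappa> * 0"
    by (intro tendsto_mult tendsto_const) (simp add: xx)
  then have d: "(\<lambda>k. hdist \<kappa> x (X k)) \<longlonglongrightarrow> 0" by (simp add: hdist_def[abs_def])
  have le: "(norm (v k))\<^sup>2 \<le> 2 * \<kappa> * (snd (X k))\<^sup>2 * (L * hdist \<kappa> x (X k))\<^sup>2" for k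
  proof -
    have "lorentz_norm (v k) \<le> L * hdist \<kappa> x (X k)"
      using L X x by (auto simp: grad_lipschitz_on_def v_def T_def)
    then have "(lorentz_norm (v k))\<^sup>2 \<le> (L * hdist \<kappa> x (X k))\<^sup>2"
      using tangent_nonneg[OF XH Xv] by (intro power_mono) (simp_all add: lorentz_norm_def)
    then have "lorentz_inner (v k) (v k) \<le> (L * hdist \<kappa> x (X k))\<^sup>2"
      using tangent_nonneg[OF XH Xv] by (simp add: lorentz_norm_def)
    then show ?thesis
      using kappa_pos by (intro order_trans[OF norm_tangent_le[OF XH Xv]] mult_left_mono) auto
  qed
  have "(\<lambda>k. 2 * \<kappa> * (snd (X k))\<^sup>2 * (L * hdist \<kappa> x (X k))\<^sup>2) \<longlonglongrightarrow>
      2 * \<kappa> * (snd x)\<^sup>2 * (L * 0)\<^sup>2"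
    by (intro tendsto_intros d lim)
  then have lim0: "(\<lambda>k. 2 * \<kappa> * (snd (X k))\<^sup>2 * (L * hdist \<kappa> x (X k))\<^sup>2) \<longlonglongrightarrow> 0" by simp
  have "(\<lambda>k. (norm (v k))\<^sup>2) \<longlonglongrightarrow> 0"
    by (rule Lim_null_comparison[OF _ lim0]) (simp add: le)
  then have v: "v \<longlonglongrightarrow> 0" by (simp add: tendsto_norm_zero_iff)
  have "T \<longlonglongrightarrow> parallel_transport \<kappa> x x (hgrad \<kappa> f x)"
    unfolding T_def[abs_def] parallel_transport_def
    by (intro tendsto_intros lorentz.tendsto lim) (simp add: xx)
  then have "T \<longlonglongrightarrow> hgrad \<kappa> f x" by (simp add: parallel_transport_def hgrad(1)[OF f xH])
  from tendsto_diff[OF this v] show ?thesis by (simp add: v_def)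
qed

text \<open>A nonzero limit length keeps the quotient by the norm continuous and eventually excludes
  the zero branch of \<open>hexp\<close>.\<close>

lemma tendsto_hexp:
  assumes X: "(X \<longlongrightarrow> x) F" and V: "(V \<longlongrightarrow> v) F" and v: "lorentz_norm v \<noteq> 0"
  shows "((\<lambda>k. hexp \<kappa> (X k) (V k)) \<longlongrightarrow> hexp \<kappa> x v) F"
proof -
  have v0: "v \<noteq> 0" using v by (auto simp: lorentz_norm_def lorentz.zero_right)
  have n: "((\<lambda>k. lorentz_norm (V k)) \<longlongrightarrow> lorentz_norm v) F"
    unfolding lorentz_norm_def by (intro tendsto_intros lorentz.tendsto V)
  have "((\<lambda>k. cosh (sqrt \<kappa> * lorentz_norm (V k)) *\<^sub>R X k +
      (sinh (sqrt \<kappa> * lorentz_norm (V k)) / (sqrt \<kappa> * lorentz_norm (V k))) *\<^sub>R V k) \<longlongrightarrow> hexp \<kappa> x v) F"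
    unfolding hexp_def if_not_P[OF v0]
    by (intro tendsto_intros n X V) (use v kappa_pos in simp)
  moreover have "\<forall>\<^sub>F k in F. cosh (sqrt \<kappa> * lorentz_norm (V k)) *\<^sub>R X k +
      (sinh (sqrt \<kappa> * lorentz_norm (V k)) / (sqrt \<kappa> * lorentz_norm (V k))) *\<^sub>R V k = hexp \<kappa> (X k) (V k)"
    using tendsto_imp_eventually_ne[OF V v0] by eventually_elim (simp add: hexp_def)
  ultimately show ?thesis by (rule Lim_transform_eventually)
qed

end

section \<open>Stationarity of cluster points\<close>

theorem theorem18:
  fixes \<kappa> L \<alpha> :: real
    and C :: "'n::finite lorentz set"
    and f :: "'n lorentz \<Rightarrow> real"
    and p :: "nat \<Rightarrow> 'n lorentz"
    and pbar :: "'n lorentz"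
  assumes "\<kappa> > 0"
    and "closedin (top_of_set (hyp_space \<kappa>)) C"
    and "hyp_convex \<kappa> C"
    and "f differentiable_on hyp_space \<kappa>"
    and "\<exists>q. is_arg_min f (\<lambda>x. x \<in> C) q"
    and "(INF q\<in>C. ereal (f q)) > - \<infinity>"
    and "L \<ge> 0"
    and "grad_lipschitz_on \<kappa> f C L"
    and "\<alpha> > 0"
    and "L > 0 \<longrightarrow> \<alpha> < 1 / L"
    and "p 0 \<in> C"
    and "\<And>k. p (Suc k) = hproj \<kappa> C (hexp \<kappa> (p k) (- \<alpha> *\<^sub>R hgrad \<kappa> f (p k)))"
    and "\<And>k. hgrad \<kappa> f (p k) \<noteq> 0"
    and "pbar \<in> C"
    and "cluster_point p pbar"
  shows "stationary_point \<kappa> f C pbar"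
proof -
  interpret hyperbolic_space_form \<kappa> by unfold_locales fact
  have CH: "C \<subseteq> hyp_space \<kappa>" using assms(3) by (simp add: hyp_convex_def)
  note step = projected_step_decrease[OF assms(4,2,3,8,7) _ assms(9) assms(13), folded assms(12)]
  have pC: "p k \<in> C" for k by (induction k) (simp_all add: assms(11) step(1))
  have pH: "p k \<in> hyp_space \<kappa>" for k using CH pC by blast
  define c d where "c = 1 / \<alpha> - L" and "d k = hdist \<kappa> (p k) (p (Suc k))" for k
  have c: "c > 0"
  proof (cases "L = 0")
    case False
    then show ?thesis using assms(7,9,10) by (simp add: c_def field_simps)
  qed (simp add: c_def assms(9))
  have dec: "f (p (Suc k)) \<le> f (p k) - c * (d k)\<^sup>2" for k
    unfolding c_def d_def by (rule step(2)[OF pC])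
  obtain q where q: "\<And>x. x \<in> C \<Longrightarrow> f q \<le> f x"
    using assms(5) by (auto simp: is_arg_min_def not_less)
  have "f (p (Suc k)) \<le> f (p k)" for k
    using dec[of k] mult_nonneg_nonneg[OF less_imp_le[OF c] zero_le_power2[of "d k"]] by linarith
  \<comment> \<open>The values decrease and are bounded below by the minimum, so they converge;
    their consecutive differences, which dominate \<open>c * (d k)\<^sup>2\<close>, tend to
    0.\<close>
  then obtain l where l: "(\<lambda>k. f (p k)) \<longlonglongrightarrow> l"
    using decseq_convergent[of "\<lambda>k. f (p k)" "f q"] q[OF pC] by (metis decseq_Suc_iff)
  have "(\<lambda>k. (f (p k) - f (p (Suc k))) / c) \<longlonglongrightarrow> (l - l) / c"
    by (intro tendsto_intros l LIMSEQ_Suc[OF l]) (use c in simp)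
  then have lim0: "(\<lambda>k. (f (p k) - f (p (Suc k))) / c) \<longlonglongrightarrow> 0" by simp
  have "(d k)\<^sup>2 \<le> (f (p k) - f (p (Suc k))) / c" for k
    using dec[of k] c by (simp add: field_simps)
  then have "(\<lambda>k. (d k)\<^sup>2) \<longlonglongrightarrow> 0"
    by (intro Lim_null_comparison[OF _ lim0]) simp
  from tendsto_real_sqrt[OF this] have d: "d \<longlonglongrightarrow> 0" by (simp add: tendsto_rabs_zero_iff)
  obtain r where r: "strict_mono r" and "(p \<circ> r) \<longlonglongrightarrow> pbar"
    using assms(15) by (auto simp: cluster_point_def)
  then have X: "(\<lambda>k. p (r k)) \<longlonglongrightarrow> pbar" by (simp add: o_def)
  \<comment> \<open>The successors \<open>p (Suc (r k))\<close> need not belong to the subsequence;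
    since \<open>d\<close> tends to 0 along the whole sequence, they share its limit.\<close>
  have "(\<lambda>k. hdist \<kappa> (p (r k)) (p (Suc (r k)))) \<longlonglongrightarrow> 0"
    using LIMSEQ_subseq_LIMSEQ[OF d r] by (simp add: o_def d_def)
  from tendsto_hdist_0[OF pH pH X this] have Y: "(\<lambda>k. p (Suc (r k))) \<longlonglongrightarrow> pbar" .
  define g where "g = hgrad \<kappa> f pbar"
  have G: "(\<lambda>k. hgrad \<kappa> f (p (r k))) \<longlonglongrightarrow> g"
    unfolding g_def by (rule tendsto_hgrad[OF assms(4) CH assms(8) pC assms(14) X])
  have pbar: "pbar \<in> hyp_space \<kappa>" using CH assms(14) by blast
  have "lorentz_inner g x \<ge> 0" if x: "x \<in> C" for x
  \<comment> \<open>A vanishing limit gradient makes the claim trivial; otherwise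
    \<open>tendsto_hexp\<close> applies.\<close>
  proof (cases "g = 0")
    case True
    then show ?thesis by (simp add: lorentz.zero_left)
  next
    case False
    from tangent_unit[OF pbar hgrad(1)[OF assms(4) pbar, folded g_def] this] obtain w where
      w: "lorentz_inner pbar w = 0" "lorentz_inner w w = 1 / \<kappa>"
      and gw: "g = (sqrt \<kappa> * lorentz_norm g) *\<^sub>R w" and n: "lorentz_norm g > 0" by metis
    define s where "s = \<alpha> * (sqrt \<kappa> * lorentz_norm g)"
    have s: "s > 0" using n assms(1,9) by (simp add: s_def)
    define Q Qbar where "Q k = hexp \<kappa> (p (r k)) (- \<alpha> *\<^sub>R hgrad \<kappa> f (p (r k)))"
      and "Qbar = hexp \<kappa> pbar (- \<alpha> *\<^sub>R g)" for k
    have "- \<alpha> *\<^sub>R g = (- s) *\<^sub>R w" by (subst gw) (simp add: s_def)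
    then have Qbar: "Qbar = cosh s *\<^sub>R pbar - sinh s *\<^sub>R w"
      using hexp_unit[OF w(2), of pbar "- s"] by (simp add: Qbar_def)
    have "lorentz_norm (- \<alpha> *\<^sub>R g) = \<alpha> * lorentz_norm g"
      using assms(9) by (simp add: lorentz_norm_def lorentz_simps real_sqrt_mult)
    then have Q: "Q \<longlonglongrightarrow> Qbar"
      unfolding Q_def Qbar_def using n assms(9) by (intro tendsto_hexp X tendsto_intros G) simp
    have "(\<lambda>k. lorentz_inner (Q k) x +
          \<kappa> * lorentz_inner (p (Suc (r k))) x * lorentz_inner (Q k) (p (Suc (r k))))
        \<longlonglongrightarrow> lorentz_inner Qbar x + \<kappa> * lorentz_inner pbar x * lorentz_inner Qbar pbar"
      by (intro tendsto_intros lorentz.tendsto Q Y)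
    then have "lorentz_inner Qbar x + \<kappa> * lorentz_inner pbar x * lorentz_inner Qbar pbar \<le> 0"
      by (rule LIMSEQ_le_const2) (use step(3)[OF pC x] in \<open>auto simp: Q_def\<close>)
    also have "lorentz_inner Qbar pbar = - cosh s / \<kappa>"
      by (simp add: Qbar lorentz_simps hyp_spaceD[OF pbar] w lorentz_inner_commute[of w pbar])
    \<comment> \<open>In the limit the iterate and its successor coincide, so the cosh terms cancel
      and only the direction \<open>w\<close> of the gradient remains.\<close>
    also have "lorentz_inner Qbar x + \<kappa> * lorentz_inner pbar x * (- cosh s / \<kappa>) =
        - (sinh s * lorentz_inner w x)"
      using assms(1) by (simp add: Qbar lorentz_simps)
    finally have "lorentz_inner w x \<ge> 0" using s by (simp add: zero_le_mult_iff)
    then show ?thesis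
      using n assms(1) by (subst gw) (simp add: lorentz_simps)
  qed
  then show ?thesis using assms(14) by (simp add: stationary_point_def g_def)
qed

end
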